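(* Let $k,l\ge 2$ be integers such that $k-1$ is divisible by $l-1$. Then every $\mathcal{C}^B_{2k}$-free ordered graph $G$ has a $\mathcal{C}^B_{2l}$-free subgraph (with the vertex ordering inherited from $G$) with at least $\frac{l-1}{k-1}\,|E(G)|$ edges.
   Context: An ordered graph is a finite simple graph together with a linear ordering of its vertex set. An ordered graph $G$ contains an ordered graph $H$ as an ordered subgraph if there is an injective, order-preserving map from the vertices of $H$ to the vertices of $G$ that maps edges of $H$ to edges of $G$ (the copy need not be induced). For a set $\mathcal{H}$ of ordered graphs, $G$ is $\mathcal{H}$-free if it contains no $H\in\mathcal{H}$ as an ordered subgraph. The interval chromatic number of an ordered graph is the minimum number of intervals into which its linearly ordered vertex set can be partitioned so that no two vertices in the same interval are adjacent. In an ordered graph with interval chromatic number $2$ and intervals $U$ and $V$ ($U$ preceding $V$), an edge joining the first vertex of $U$ to the last vertex of $V$ is called an outer border, and an edge joining the last vertex of $U$ to the first vertex of $V$ is called an inner border. A bordered cycle is an ordered cycle (an ordered graph whose underlying graph is a cycle) with interval chromatic number $2$ that contains both an inner border and an outer border. $\mathcal{C}^B_{2j}$ is the set of all bordered cycles of length $2j$ (up to order-preserving isomorphism). *)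

theory Defs
  imports Complex_Main "HOL-Library.Disjoint_Sets"
begin

text \<open>The linear ordering of the vertex set is the one inherited from the ambient type of class
  \<^class>\<open>linorder\<close>, so a subgraph automatically carries the inherited ordering.\<close>

record 'a ograph =
  verts :: "'a set"
  edges :: "'a set set"

definition ordered_graph :: "'a::linorder ograph \<Rightarrow> bool" where
  "ordered_graph G \<longleftrightarrow> finite (verts G) \<and> (\<forall>e\<in>edges G. e \<subseteq> verts G \<and> card e = 2)"

definition subgraph :: "'a::linorder ograph \<Rightarrow> 'a ograph \<Rightarrow> bool" where
  "subgraph H G \<longleftrightarrow> ordered_graph H \<and> verts H \<subseteq> verts G \<and> edges H \<subseteq> edges G"

definition contains_ordered :: "'a::linorder ograph \<Rightarrow> 'b::linorder ograph \<Rightarrow> bool" where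
  "contains_ordered G H \<longleftrightarrow>
     (\<exists>f. inj_on f (verts H) \<and> mono_on (verts H) f \<and> f ` verts H \<subseteq> verts G \<and>
          (\<forall>e\<in>edges H. f ` e \<in> edges G))"

definition free_of :: "'b::linorder ograph set \<Rightarrow> 'a::linorder ograph \<Rightarrow> bool" where
  "free_of \<H> G \<longleftrightarrow> (\<forall>H\<in>\<H>. \<not> contains_ordered G H)"

definition interval_in :: "'a::linorder set \<Rightarrow> 'a set \<Rightarrow> bool" where
  "interval_in X I \<longleftrightarrow> I \<subseteq> X \<and> (\<forall>x\<in>I. \<forall>y\<in>I. \<forall>z\<in>X. x \<le> z \<and> z \<le> y \<longrightarrow> z \<in> I)"

definition independent_in :: "'a ograph \<Rightarrow> 'a set \<Rightarrow> bool" where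
  "independent_in G I \<longleftrightarrow> (\<forall>x\<in>I. \<forall>y\<in>I. {x, y} \<notin> edges G)"

definition interval_coloring :: "'a::linorder ograph \<Rightarrow> 'a set set \<Rightarrow> bool" where
  "interval_coloring G P \<longleftrightarrow>
     partition_on (verts G) P \<and> (\<forall>I\<in>P. interval_in (verts G) I \<and> independent_in G I)"

definition interval_chromatic_number :: "'a::linorder ograph \<Rightarrow> nat" where
  "interval_chromatic_number G = (LEAST n. \<exists>P. interval_coloring G P \<and> card P = n)"

definition outer_border :: "'a::linorder set \<Rightarrow> 'a set \<Rightarrow> 'a set" where
  "outer_border U W = {Min U, Max W}"

definition inner_border :: "'a::linorder set \<Rightarrow> 'a set \<Rightarrow> 'a set" where
  "inner_border U W = {Max U, Min W}"

definition ordered_cycle :: "nat \<Rightarrow> 'a::linorder ograph \<Rightarrow> bool" where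
  "ordered_cycle n G \<longleftrightarrow> ordered_graph G \<and> n \<ge> 3 \<and>
     (\<exists>c. bij_betw c {..<n} (verts G) \<and> edges G = (\<lambda>i. {c i, c (Suc i mod n)}) ` {..<n})"

definition bordered_cycle :: "nat \<Rightarrow> 'a::linorder ograph \<Rightarrow> bool" where
  "bordered_cycle n G \<longleftrightarrow> ordered_cycle n G \<and> interval_chromatic_number G = 2 \<and>
     (\<exists>U W. interval_coloring G {U, W} \<and> (\<forall>u\<in>U. \<forall>w\<in>W. u < w) \<and>
            outer_border U W \<in> edges G \<and> inner_border U W \<in> edges G)"

text \<open>Every finite ordered graph is order-isomorphic to one with vertices in \<^typ>\<open>nat\<close>, so
  this set represents all bordered cycles of length \<open>n\<close> up to order-preserving isomorphism.\<close>

definition bordered_cycles :: "nat \<Rightarrow> nat ograph set" where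
  "bordered_cycles n = {C. bordered_cycle n C}"

end

theory Submission
  imports Defs
begin

text \<open>If the inner border of one bordered cycle is the outer border of another, deleting this edge
  from their union leaves a bordered cycle, because the second cycle lies between the two ends of
  the shared edge. Hence a chain of \<open>m = (k - 1) / (l - 1)\<close> bordered cycles of length \<open>2 l\<close>, linked
  in this way, would produce a bordered cycle of length \<open>2 k\<close>. Classify the edges by the length of
  the longest chain starting at them: at most \<open>m\<close> classes occur, and no class contains both borders
  of a bordered \<open>2 l\<close>-cycle. The largest class is the desired subgraph.\<close>

section \<open>Cycles as closed paths\<close>

fun path_edges :: "'a list \<Rightarrow> 'a set set" where
  "path_edges (x # y # zs) = insert {x, y} (path_edges (y # zs))"
| "path_edges _ = {}"

lemma path_edges_append:
  "path_edges (xs @ ys) = path_edges xs \<union> path_edges ys \<union>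
     (if xs = [] \<or> ys = [] then {} else {{last xs, hd ys}})"
proof (induction xs rule: path_edges.induct)
  case (1 x y zs)
  then show ?case by auto
next
  case ("2_2" v)
  then show ?case by (cases ys) auto
qed auto

lemma path_edges_rev: "path_edges (rev xs) = path_edges xs"
proof (induction xs rule: path_edges.induct)
  case (1 x y zs)
  have "path_edges (rev (x # y # zs)) = path_edges (rev (y # zs) @ [x])" by simp
  also have "\<dots> = path_edges (rev (y # zs)) \<union> {{y, x}}"
    by (subst path_edges_append) simp
  also have "\<dots> = path_edges (x # y # zs)"
    unfolding 1 by (simp add: insert_commute[of x y])
  finally show ?case .
qed simp_all

lemma path_edges_conv_nth:
  "path_edges xs = {{xs ! i, xs ! Suc i} |i. Suc i < length xs}"
proof (induction xs rule: path_edges.induct)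
  case (1 x y zs)
  have "{{(x # y # zs) ! i, (x # y # zs) ! Suc i} |i. Suc i < length (x # y # zs)}
      = insert {x, y} {{(y # zs) ! i, (y # zs) ! Suc i} |i. Suc i < length (y # zs)}"
    (is "?L = ?R")
  proof
    show "?L \<subseteq> ?R"
    proof
      fix e assume "e \<in> ?L"
      then obtain i where i: "Suc i < length (x # y # zs)"
        "e = {(x # y # zs) ! i, (x # y # zs) ! Suc i}" by blast
      show "e \<in> ?R"
      proof (cases i)
        case 0
        then show ?thesis using i by simp
      next
        case (Suc j)
        then have "e = {(y # zs) ! j, (y # zs) ! Suc j}" "Suc j < length (y # zs)"
          using i by auto
        then show ?thesis by blast
      qed
    qed
    show "?R \<subseteq> ?L"
    proof
      fix e assume "e \<in> ?R"
      then consider "e = {x, y}" | j where "Suc j < length (y # zs)"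
        "e = {(y # zs) ! j, (y # zs) ! Suc j}" by blast
      then show "e \<in> ?L"
      proof cases
        case 1
        then show ?thesis by (intro CollectI exI[of _ 0]) auto
      next
        case 2
        then show ?thesis by (intro CollectI exI[of _ "Suc j"]) auto
      qed
    qed
  qed
  then show ?case using 1 by simp
qed auto

text \<open>The reduction modulo \<open>n\<close> takes effect only at \<open>i = n - 1\<close>,
  which yields the closing edge; all other indices give consecutive entries of the list.\<close>

lemma cyclic_edges_conv_path_edges:
  assumes "n > 0"
  shows "(\<lambda>i. {c i, c (Suc i mod n)}) ` {..<n}
    = insert {c 0, c (n - 1)} (path_edges (map c [0..<n]))"
proof -
  obtain m where n: "n = Suc m" using assms by (cases n) auto
  have "(\<lambda>i. {c i, c (Suc i mod n)}) ` {..<m} = (\<lambda>i. {c i, c (Suc i)}) ` {..<m}"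
    using n by (intro image_cong) auto
  moreover have "path_edges (map c [0..<n])
      = (\<lambda>i. {map c [0..<n] ! i, map c [0..<n] ! Suc i}) ` {..<m}"
  proof -
    have "{..<m} = {i. Suc i < length (map c [0..<n])}" using n by auto
    then show ?thesis unfolding path_edges_conv_nth by blast
  qed
  moreover have "\<dots> = (\<lambda>i. {c i, c (Suc i)}) ` {..<m}"
    using n by (intro image_cong) (auto simp del: upt_Suc)
  ultimately show ?thesis
    using n by (auto simp: lessThan_Suc insert_commute)
qed

lemma ordered_cycle_of_path:
  assumes "distinct xs" "length xs = n" "n \<ge> 3"
    "verts H = set xs" "edges H = insert {hd xs, last xs} (path_edges xs)" "ordered_graph H"
  shows "ordered_cycle n H"
proof -
  have "xs \<noteq> []" using assms by auto
  moreover have "map (nth xs) [0..<n] = xs" using assms(2) map_nth by blast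
  ultimately have "edges H = insert {xs ! 0, xs ! (n - 1)} (path_edges (map (nth xs) [0..<n]))"
    using assms(2,5) by (simp add: hd_conv_nth last_conv_nth)
  also have "\<dots> = (\<lambda>i. {xs ! i, xs ! (Suc i mod n)}) ` {..<n}"
    using assms by (subst cyclic_edges_conv_path_edges) auto
  finally show ?thesis
    using assms bij_betw_nth[of xs "{..<n}" "verts H"] unfolding ordered_cycle_def by blast
qed

text \<open>Any edge of a cycle can play the role of the closing edge: rotate the enumeration so
  that it starts just after that edge, and reverse it if the ends come out in the wrong order.
  Deleting a shared border then amounts to keeping only the path.\<close>

lemma ordered_cycle_pathE:
  assumes "ordered_cycle n H" "{x, y} \<in> edges H"
  obtains xs where "distinct xs" "length xs = n" "set xs = verts H" "hd xs = x" "last xs = y"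
    "edges H = insert {x, y} (path_edges xs)"
proof -
  from assms(1) obtain c where n: "n \<ge> 3" and c: "bij_betw c {..<n} (verts H)"
    and E: "edges H = (\<lambda>i. {c i, c (Suc i mod n)}) ` {..<n}"
    unfolding ordered_cycle_def by blast
  obtain i where i: "i < n" "{x, y} = {c i, c (Suc i mod n)}" using assms(2) E by auto
  \<comment> \<open>The enumeration is cut behind position \<open>i\<close>, so that
    \<open>as @ bs\<close> runs from \<open>c (Suc i mod n)\<close> round to \<open>c i\<close>. For
    \<open>i = n - 1\<close> the part \<open>as\<close> is empty and the path starts at
    \<open>c 0\<close>.\<close>
  define as where "as = map c [Suc i..<n]"
  define bs where "bs = map c [0..<Suc i]"
  have [simp]: "bs \<noteq> []" by (simp add: bs_def)
  have split: "[0..<n] = [0..<Suc i] @ [Suc i..<n]"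
    using i(1) upt_add_eq_append[of 0 "Suc i" "n - Suc i"] by simp
  have lst: "last bs = c i" "hd bs = c 0" "as \<noteq> [] \<Longrightarrow> last as = c (n - 1)"
    "as \<noteq> [] \<Longrightarrow> hd as = c (Suc i)"
    by (auto simp: bs_def as_def hd_map hd_append last_map simp del: upt_Suc)
  have ne: "as \<noteq> [] \<longleftrightarrow> Suc i < n" by (auto simp: as_def)
  have hd: "hd (as @ bs) = c (Suc i mod n)"
    using lst ne i(1) by (cases "Suc i < n") (auto simp: hd_append not_less le_Suc_eq less_Suc_eq_le)
  have "edges H = insert {c 0, c (n - 1)} (path_edges (bs @ as))"
    using cyclic_edges_conv_path_edges[of n c] n E by (simp add: as_def bs_def split)
  then have edg: "edges H = insert {x, y} (path_edges (as @ bs))"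
    using lst ne i by (cases "Suc i < n")
      (auto simp: path_edges_append insert_commute not_less le_Suc_eq)
  have "inj_on c {..<n}" using c by (simp add: bij_betw_def)
  then have "distinct (map c [0..<n])" by (simp add: distinct_map atLeast0LessThan)
  then have dist: "distinct (as @ bs)" unfolding split as_def bs_def by auto
  have len: "length (as @ bs) = n" using i by (simp add: as_def bs_def)
  have "set (as @ bs) = set (map c [0..<n])" unfolding split as_def bs_def by auto
  then have set: "set (as @ bs) = verts H" using c by (simp add: bij_betw_def atLeast0LessThan)
  have last: "last (as @ bs) = c i" using lst by simp
  from i(2) consider "x = c (Suc i mod n)" "y = c i" | "x = c i" "y = c (Suc i mod n)"
    by (auto simp: doubleton_eq_iff)
  then show thesis
  proof cases
    case 1
    then show ?thesis using that[of "as @ bs"] dist len set last hd edg by simp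
  next
    case 2
    have "hd (rev (as @ bs)) = x" "last (rev (as @ bs)) = y"
      unfolding hd_rev last_rev using 2 last hd by auto
    moreover have "edges H = insert {x, y} (path_edges (rev (as @ bs)))"
      by (simp only: path_edges_rev edg)
    ultimately show ?thesis
      using dist len set by (intro that[of "rev (as @ bs)"]) (simp_all only: distinct_rev length_rev set_rev)
  qed
qed

section \<open>Bordered cycles with prescribed borders\<close>

text \<open>Naming the outer border \<open>e\<close> and the inner border \<open>f\<close> allows
  cycles to be linked. Since edges have two elements and \<open>U\<close> lies before
  \<open>W\<close>, the demand that every edge meets both sides says that \<open>U\<close> and
  \<open>W\<close> are independent; the interval chromatic number is recovered in
  \<open>bordered_at_imp_bordered_cycle\<close>.\<close>

definition bordered_at :: "nat \<Rightarrow> 'a::linorder ograph \<Rightarrow> 'a set \<Rightarrow> 'a set \<Rightarrow> bool" where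
  "bordered_at n H e f \<longleftrightarrow> ordered_cycle n H \<and>
     (\<exists>U W. U \<noteq> {} \<and> W \<noteq> {} \<and> verts H = U \<union> W \<and> (\<forall>u\<in>U. \<forall>w\<in>W. u < w) \<and>
       (\<forall>d\<in>edges H. d \<inter> U \<noteq> {} \<and> d \<inter> W \<noteq> {}) \<and>
       e = outer_border U W \<and> f = inner_border U W \<and> e \<in> edges H \<and> f \<in> edges H)"

lemma bordered_atI:
  assumes "ordered_cycle n H" "U \<noteq> {}" "W \<noteq> {}" "verts H = U \<union> W" "\<forall>u\<in>U. \<forall>w\<in>W. u < w"
    "\<forall>d\<in>edges H. d \<inter> U \<noteq> {} \<and> d \<inter> W \<noteq> {}"
    "outer_border U W \<in> edges H" "inner_border U W \<in> edges H"
  shows "bordered_at n H (outer_border U W) (inner_border U W)"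
proof -
  have "\<exists>U' W'. U' \<noteq> {} \<and> W' \<noteq> {} \<and> verts H = U' \<union> W' \<and> (\<forall>u\<in>U'. \<forall>w\<in>W'. u < w) \<and>
       (\<forall>d\<in>edges H. d \<inter> U' \<noteq> {} \<and> d \<inter> W' \<noteq> {}) \<and>
       outer_border U W = outer_border U' W' \<and> inner_border U W = inner_border U' W' \<and>
       outer_border U W \<in> edges H \<and> inner_border U W \<in> edges H"
    by (rule exI[of _ U], rule exI[of _ W]) (use assms in simp)
  then show ?thesis using assms(1) by (simp add: bordered_at_def)
qed

lemma bordered_cycle_imp_bordered_at:
  assumes "bordered_cycle n H"
  obtains e f where "bordered_at n H e f"
proof -
  from assms obtain U W where cyc: "ordered_cycle n H" and col: "interval_coloring H {U, W}"
    and less: "\<forall>u\<in>U. \<forall>w\<in>W. u < w"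
    and bd: "outer_border U W \<in> edges H" "inner_border U W \<in> edges H"
    unfolding bordered_cycle_def by blast
  have og: "ordered_graph H" using cyc by (simp add: ordered_cycle_def)
  have ne: "U \<noteq> {}" "W \<noteq> {}" and un: "verts H = U \<union> W"
    using col by (auto simp: interval_coloring_def partition_on_def)
  have "d \<inter> U \<noteq> {} \<and> d \<inter> W \<noteq> {}" if "d \<in> edges H" for d
  proof -
    have "d \<subseteq> verts H" "card d = 2" using og that by (auto simp: ordered_graph_def)
    then obtain x y where d: "d = {x, y}" "x \<in> verts H" "y \<in> verts H"
      by (auto simp: card_2_iff)
    have "\<not> (x \<in> I \<and> y \<in> I)" if "I \<in> {U, W}" for I
      using col that d \<open>d \<in> edges H\<close> unfolding interval_coloring_def independent_in_def by blast
    then show ?thesis using d un by auto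
  qed
  then have cross: "\<forall>d\<in>edges H. d \<inter> U \<noteq> {} \<and> d \<inter> W \<noteq> {}" by blast
  have "bordered_at n H (outer_border U W) (inner_border U W)"
    by (rule bordered_atI[OF cyc ne un less cross bd])
  then show thesis by (rule that)
qed

lemma bordered_at_imp_bordered_cycle:
  assumes "bordered_at n H e f"
  shows "bordered_cycle n H"
proof -
  from assms obtain U W where cyc: "ordered_cycle n H" and ne: "U \<noteq> {}" "W \<noteq> {}"
    and un: "verts H = U \<union> W" and less: "\<forall>u\<in>U. \<forall>w\<in>W. u < w"
    and cross: "\<forall>d\<in>edges H. d \<inter> U \<noteq> {} \<and> d \<inter> W \<noteq> {}"
    and bd: "outer_border U W \<in> edges H" "inner_border U W \<in> edges H"
    unfolding bordered_at_def by blast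
  have og: "ordered_graph H" using cyc by (simp add: ordered_cycle_def)
  have disj: "U \<inter> W = {}" using less by fastforce
  then have neq: "U \<noteq> W" using ne by auto
  have part: "partition_on (verts H) {U, W}"
    using ne un disj by (auto simp: partition_on_def disjoint_def)
  have int: "interval_in (verts H) U" "interval_in (verts H) W"
    using less un disj unfolding interval_in_def by (auto, (meson leD le_less_trans less_le_trans order.strict_trans1)+)
  have ind: "independent_in H U" "independent_in H W"
    using cross disj by (fastforce simp: independent_in_def)+
  have col: "interval_coloring H {U, W}"
    using part int ind by (simp add: interval_coloring_def)
  have "interval_chromatic_number H = 2"
    unfolding interval_chromatic_number_def
  proof (rule Least_equality)
    show "\<exists>P. interval_coloring H P \<and> card P = 2"
      using col neq by (intro exI[of _ "{U, W}"]) auto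
  next
    fix m assume "\<exists>P. interval_coloring H P \<and> card P = m"
    then obtain P where P: "interval_coloring H P" "card P = m" by blast
    then have pP: "partition_on (verts H) P" by (simp add: interval_coloring_def)
    have "finite P"
      using pP og finite_elements unfolding ordered_graph_def by blast
    moreover have "P \<noteq> {}" using pP un ne by (auto simp: partition_on_def)
    \<comment> \<open>A single interval would be the whole vertex set, which is not independent
      because it contains the ends of the outer border.\<close>
    moreover have "P \<noteq> {I}" for I
    proof
      assume I: "P = {I}"
      then have "I = verts H" using pP by (auto simp: partition_on_def)
      then have "independent_in H (verts H)" using P I by (simp add: interval_coloring_def)
      moreover have "{Min U, Max W} \<in> edges H" using bd by (simp add: outer_border_def)
      moreover have "{Min U, Max W} \<subseteq> verts H"
        using og \<open>{Min U, Max W} \<in> edges H\<close> by (auto simp: ordered_graph_def)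
      ultimately show False by (auto simp: independent_in_def)
    qed
    ultimately have "card P \<noteq> 0" "card P \<noteq> 1" by (auto simp: card_1_singleton_iff)
    then show "2 \<le> m" using P by linarith
  qed
  then show ?thesis using cyc col less bd unfolding bordered_cycle_def by blast
qed

section \<open>Containment and order-isomorphic copies\<close>

definition image_graph :: "('a \<Rightarrow> 'b) \<Rightarrow> 'a ograph \<Rightarrow> 'b ograph" where
  "image_graph g H = \<lparr>verts = g ` verts H, edges = (`) g ` edges H\<rparr>"

lemma ordered_cycle_image:
  assumes "ordered_cycle n H" "inj_on g (verts H)"
  shows "ordered_cycle n (image_graph g H)"
proof -
  from assms(1) obtain c where og: "ordered_graph H" and n: "n \<ge> 3"
    and c: "bij_betw c {..<n} (verts H)"
    and E: "edges H = (\<lambda>i. {c i, c (Suc i mod n)}) ` {..<n}"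
    unfolding ordered_cycle_def by blast
  have "card (g ` d) = 2" if "d \<in> edges H" for d
    using that og card_image[OF inj_on_subset[OF assms(2)]] by (auto simp: ordered_graph_def)
  then have "ordered_graph (image_graph g H)"
    using og by (auto simp: ordered_graph_def image_graph_def)
  moreover have "bij_betw (g \<circ> c) {..<n} (verts (image_graph g H))"
    using bij_betw_trans[OF c inj_on_imp_bij_betw[OF assms(2)]] by (simp add: image_graph_def)
  moreover have "edges (image_graph g H) = (\<lambda>i. {(g \<circ> c) i, (g \<circ> c) (Suc i mod n)}) ` {..<n}"
    by (simp add: image_graph_def E image_image)
  ultimately show ?thesis using n unfolding ordered_cycle_def by blast
qed

text \<open>A strictly monotone map commutes with \<open>Min\<close> and \<open>Max\<close> of
  nonempty finite sets, so it carries borders to borders.\<close>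

lemma bordered_at_image:
  fixes g :: "'a::linorder \<Rightarrow> 'b::linorder"
  assumes "bordered_at n H e f" "strict_mono_on (verts H) g"
  shows "bordered_at n (image_graph g H) (g ` e) (g ` f)"
proof -
  from assms(1) obtain U W where cyc: "ordered_cycle n H" and ne: "U \<noteq> {}" "W \<noteq> {}"
    and un: "verts H = U \<union> W" and less: "\<forall>u\<in>U. \<forall>w\<in>W. u < w"
    and cross: "\<forall>d\<in>edges H. d \<inter> U \<noteq> {} \<and> d \<inter> W \<noteq> {}"
    and bd: "e = outer_border U W" "f = inner_border U W" "e \<in> edges H" "f \<in> edges H"
    unfolding bordered_at_def by blast
  have inj: "inj_on g (verts H)" using assms(2) by (rule strict_mono_on_imp_inj_on)
  have mono: "g x \<le> g y" if "x \<in> verts H" "y \<in> verts H" "x \<le> y" for x y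
    using assms(2) that by (metis order_le_less strict_mono_onD)
  have fin: "finite U" "finite W"
    using cyc un by (auto simp: ordered_cycle_def ordered_graph_def)
  have Mn: "Min (g ` A) = g (Min A)" and Mx: "Max (g ` A) = g (Max A)"
    if "finite A" "A \<noteq> {}" "A \<subseteq> verts H" for A
  proof -
    have A: "Min A \<in> A" "Max A \<in> A" using that by simp_all
    show "Min (g ` A) = g (Min A)"
      by (rule Min_eqI) (use that A in \<open>blast intro: mono Min_le\<close>)+
    show "Max (g ` A) = g (Max A)"
      by (rule Max_eqI) (use that A in \<open>blast intro: mono Max_ge\<close>)+
  qed
  have e: "g ` e = outer_border (g ` U) (g ` W)" "g ` f = inner_border (g ` U) (g ` W)"
    using fin ne un by (simp_all add: bd outer_border_def inner_border_def Mn Mx)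
  have "\<forall>u\<in>g ` U. \<forall>w\<in>g ` W. u < w"
    using less assms(2) un by (auto intro: strict_mono_onD)
  moreover have "\<forall>d\<in>edges (image_graph g H). d \<inter> g ` U \<noteq> {} \<and> d \<inter> g ` W \<noteq> {}"
    using cross by (fastforce simp: image_graph_def)
  moreover have "g ` e \<in> edges (image_graph g H)" "g ` f \<in> edges (image_graph g H)"
    using bd by (auto simp: image_graph_def)
  moreover have "verts (image_graph g H) = g ` U \<union> g ` W"
    by (simp add: image_graph_def un image_Un)
  ultimately show ?thesis
    using bordered_atI[OF ordered_cycle_image[OF cyc inj], of "g ` U" "g ` W"] ne e by simp
qed

text \<open>For fixed \<open>n\<close> and \<open>G\<close> this is a binary relation on edge sets,
  from outer to inner border. Its relational powers are the chains of linked cycles.\<close>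

definition cycle_in :: "nat \<Rightarrow> 'a::linorder ograph \<Rightarrow> 'a set \<Rightarrow> 'a set \<Rightarrow> bool" where
  "cycle_in n G e f \<longleftrightarrow>
     (\<exists>H. verts H \<subseteq> verts G \<and> edges H \<subseteq> edges G \<and> bordered_at n H e f)"

lemma cycle_in_borders: "cycle_in n G e f \<Longrightarrow> e \<in> edges G \<and> f \<in> edges G"
  unfolding cycle_in_def bordered_at_def by (elim exE conjE) (simp add: subsetD)

text \<open>Forbidden cycles live on \<open>nat\<close>, whereas \<open>cycle_in\<close> speaks of
  subgraphs of \<open>G\<close> itself. A subgraph is moved to \<open>nat\<close> by replacing
  vertices by their ranks; conversely, the image of an embedded cycle is a subgraph of
  \<open>G\<close>.\<close>

lemma free_of_bordered_cycles_iff: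
  fixes G :: "'a::linorder ograph"
  shows "free_of (bordered_cycles n) G \<longleftrightarrow> (\<nexists>e f. cycle_in n G e f)"
proof
  assume free: "free_of (bordered_cycles n) G"
  show "\<nexists>e f. cycle_in n G e f"
  proof
    assume "\<exists>e f. cycle_in n G e f"
    then obtain e f H where H: "verts H \<subseteq> verts G" "edges H \<subseteq> edges G" "bordered_at n H e f"
      unfolding cycle_in_def by blast
    have og: "ordered_graph H" using H(3) by (simp add: bordered_at_def ordered_cycle_def)
    then have "finite (verts H)" by (simp add: ordered_graph_def)
    \<comment> \<open>Here \<open>h\<close> lists the vertices in increasing order and
      \<open>g\<close> returns the rank of a vertex; \<open>h\<close> then embeds the copy on
      \<open>nat\<close> back into \<open>G\<close>.\<close>
    define zs where "zs = sorted_list_of_set (verts H)"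
    define I where "I = {..<length zs}"
    define h where "h = nth zs"
    define g where "g = inv_into I h"
    have zs: "sorted_wrt (<) zs" "set zs = verts H" "distinct zs"
      using \<open>finite (verts H)\<close> by (simp_all add: zs_def)
    have h: "bij_betw h I (verts H)"
      unfolding h_def I_def using zs by (intro bij_betw_nth) auto
    have hless: "h x < h y" if "x \<in> I" "y \<in> I" "x < y" for x y
      using zs(1) that by (simp add: h_def I_def sorted_wrt_nth_less)
    have hI: "h ` I = verts H" "inj_on h I" using h by (simp_all add: bij_betw_def)
    have hg: "h (g x) = x" "g x \<in> I" if "x \<in> verts H" for x
      using that hI f_inv_into_f[of x h I] inv_into_into[of x h I] by (auto simp: g_def)
    have hmono: "h x \<le> h y" if "x \<in> I" "y \<in> I" "x \<le> y" for x y
      using hless that by (metis order_le_less)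
    have "strict_mono_on (verts H) g"
      by (rule strict_mono_onI) (metis hg hmono not_less)
    then have "bordered_at n (image_graph g H) (g ` e) (g ` f)"
      using H(3) by (rule bordered_at_image[rotated])
    then have "image_graph g H \<in> bordered_cycles n"
      by (auto simp: bordered_cycles_def intro: bordered_at_imp_bordered_cycle)
    moreover have "contains_ordered G (image_graph g H)"
      unfolding contains_ordered_def
    proof (intro exI[of _ h] conjI ballI)
      have sub: "g ` verts H \<subseteq> I" using hg by auto
      show "inj_on h (verts (image_graph g H))"
        using inj_on_subset[OF hI(2) sub] by (simp add: image_graph_def)
      show "mono_on (verts (image_graph g H)) h"
        using hmono sub by (auto simp: image_graph_def intro!: mono_onI)
      show "h ` verts (image_graph g H) \<subseteq> verts G"
        using hg H by (auto simp: image_graph_def)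
      fix d assume "d \<in> edges (image_graph g H)"
      then obtain d' where d': "d = g ` d'" "d' \<in> edges H" by (auto simp: image_graph_def)
      then have "d' \<subseteq> verts H" using og by (auto simp: ordered_graph_def)
      then have "h ` d = d'" using hg unfolding d' image_image by force
      then show "h ` d \<in> edges G" using d' H by auto
    qed
    ultimately show False using free by (auto simp: free_of_def)
  qed
next
  assume none: "\<nexists>e f. cycle_in n G e f"
  show "free_of (bordered_cycles n) G"
    unfolding free_of_def
  proof (intro ballI notI)
    fix H assume "H \<in> bordered_cycles n" and cont: "contains_ordered G H"
    then obtain e f where H: "bordered_at n H e f"
      by (auto simp: bordered_cycles_def elim: bordered_cycle_imp_bordered_at)
    from cont obtain g where g: "inj_on g (verts H)" "mono_on (verts H) g"
      "g ` verts H \<subseteq> verts G" "\<forall>e\<in>edges H. g ` e \<in> edges G"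
      unfolding contains_ordered_def by blast
    have "strict_mono_on (verts H) g"
    proof (rule strict_mono_onI)
      fix x y assume "x \<in> verts H" "y \<in> verts H" "x < y"
      then show "g x < g y"
        using g(1,2) by (metis inj_onD mono_onD order_le_less less_irrefl)
    qed
    then have "bordered_at n (image_graph g H) (g ` e) (g ` f)"
      using H by (rule bordered_at_image[rotated])
    then have "cycle_in n G (g ` e) (g ` f)"
      using g unfolding cycle_in_def by (intro exI[of _ "image_graph g H"]) (auto simp: image_graph_def)
    then show False using none by blast
  qed
qed

section \<open>Gluing along a common border\<close>

text \<open>Equal borders would make both \<open>U\<close> and \<open>W\<close> singletons, leaving
  too few vertices for a cycle. This guarantees that deleting the shared border in a gluing keeps
  the two other borders.\<close>

lemma bordered_at_borders_neq:
  assumes "ordered_cycle n H" "verts H = U \<union> W" "U \<noteq> {}" "W \<noteq> {}" "\<forall>u\<in>U. \<forall>w\<in>W. u < w"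
  shows "outer_border U W \<noteq> inner_border U W"
proof
  assume eq: "outer_border U W = inner_border U W"
  have fin: "finite U" "finite W" and n: "n \<ge> 3" and card: "card (verts H) = n"
    using assms(1,2) by (auto simp: ordered_cycle_def ordered_graph_def dest: bij_betw_same_card)
  have less: "Min U < Max W" "Max U < Min W" "Min U < Min W" "Max U < Max W"
    using assms(3-5) fin by auto
  then have "Min U = Max U" "Min W = Max W"
    using eq by (auto simp: outer_border_def inner_border_def doubleton_eq_iff)
  then have "U \<subseteq> {Max U}" "W \<subseteq> {Max W}"
    using fin by (metis Max_ge Min_le antisym singletonI subsetI)+
  then have "verts H \<subseteq> {Max U, Max W}" using assms(2) by auto
  then have "card (verts H) \<le> card {Max U, Max W}" by (intro card_mono) auto
  also have "\<dots> \<le> 2" by (simp add: card_insert_if)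
  finally show False using n card by simp
qed

text \<open>With \<open>f = {x, y}\<close>, the other vertices of the second cycle lie strictly
  between \<open>x\<close> and \<open>y\<close>, where the first cycle has no vertices. The cycles
  thus share exactly two vertices, which explains the length, and the remaining two paths from
  \<open>x\<close> to \<open>y\<close> form one cycle.\<close>

lemma cycle_in_glue:
  assumes "cycle_in p G e f" "cycle_in q G f g"
  shows "cycle_in (p + q - 2) G e g"
proof -
  from assms(1) obtain H1 U1 W1 where H1: "verts H1 \<subseteq> verts G" "edges H1 \<subseteq> edges G"
    and cyc1: "ordered_cycle p H1" and ne1: "U1 \<noteq> {}" "W1 \<noteq> {}"
    and un1: "verts H1 = U1 \<union> W1" and less1: "\<forall>u\<in>U1. \<forall>w\<in>W1. u < w"
    and cross1: "\<forall>d\<in>edges H1. d \<inter> U1 \<noteq> {} \<and> d \<inter> W1 \<noteq> {}"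
    and bd1: "e = outer_border U1 W1" "f = inner_border U1 W1" "e \<in> edges H1" "f \<in> edges H1"
    unfolding cycle_in_def bordered_at_def by blast
  from assms(2) obtain H2 U2 W2 where H2: "verts H2 \<subseteq> verts G" "edges H2 \<subseteq> edges G"
    and cyc2: "ordered_cycle q H2" and ne2: "U2 \<noteq> {}" "W2 \<noteq> {}"
    and un2: "verts H2 = U2 \<union> W2" and less2: "\<forall>u\<in>U2. \<forall>w\<in>W2. u < w"
    and cross2: "\<forall>d\<in>edges H2. d \<inter> U2 \<noteq> {} \<and> d \<inter> W2 \<noteq> {}"
    and bd2: "f = outer_border U2 W2" "g = inner_border U2 W2" "f \<in> edges H2" "g \<in> edges H2"
    unfolding cycle_in_def bordered_at_def by blast
  have og: "ordered_graph H1" "ordered_graph H2" and pq: "p \<ge> 3" "q \<ge> 3"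
    using cyc1 cyc2 by (auto simp: ordered_cycle_def)
  then have fin: "finite U1" "finite W1" "finite U2" "finite W2"
    using un1 un2 by (auto simp: ordered_graph_def)
  define x y where "x = Max U1" and "y = Min W1"
  have xy: "x < y" using less1 ne1 fin by (auto simp: x_def y_def)
  \<comment> \<open>Both descriptions of \<open>f\<close> list the smaller end first, so the
    equality of the two pairs holds entry by entry.\<close>
  have "Min U2 < Max W2" using less2 ne2 fin by auto
  then have xy2: "Min U2 = x" "Max W2 = y" and f: "f = {x, y}"
    using xy bd1(2) bd2(1)
    by (auto simp: outer_border_def inner_border_def x_def y_def doubleton_eq_iff)
  have ord: "\<And>u. u \<in> U1 \<Longrightarrow> u \<le> x" "\<And>w. w \<in> W1 \<Longrightarrow> y \<le> w"
    "\<And>u. u \<in> U2 \<Longrightarrow> x \<le> u" "\<And>w. w \<in> W2 \<Longrightarrow> w \<le> y"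
    using fin by (auto simp: x_def y_def xy2[symmetric])
      (simp_all add: x_def[symmetric] y_def[symmetric] xy2[symmetric])
  have mem: "x \<in> U1" "y \<in> W1" "x \<in> U2" "y \<in> W2"
    using fin ne1 ne2 Max_in[of U1] Min_in[of W1] Min_in[of U2] Max_in[of W2] xy2
    by (auto simp: x_def y_def)
  obtain xs where xs: "distinct xs" "length xs = p" "set xs = verts H1" "hd xs = x" "last xs = y"
    "edges H1 = insert {x, y} (path_edges xs)"
    using ordered_cycle_pathE[OF cyc1] bd1(4) f by metis
  obtain ys where ys: "distinct ys" "length ys = q" "set ys = verts H2" "hd ys = x" "last ys = y"
    "edges H2 = insert {x, y} (path_edges ys)"
    using ordered_cycle_pathE[OF cyc2] bd2(3) f by metis
  \<comment> \<open>The interior of the second path; it is nonempty because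
    \<open>q \<ge> 3\<close>.\<close>
  obtain ms where ms: "ys = x # ms @ [y]" "ms \<noteq> []"
  proof -
    obtain zs where zs: "ys = x # zs" using ys(2,4) pq by (cases ys) auto
    moreover have "zs \<noteq> []" using zs ys(2) pq by auto
    ultimately have "ys = x # butlast zs @ [y]"
      using ys(5) by (metis append_butlast_last_id last_ConsR)
    moreover have "butlast zs \<noteq> []" using zs ys(2) pq by (simp flip: length_greater_0_conv)
    ultimately show thesis by (rule that)
  qed
  have strict: "x < v \<and> v < y" if "v \<in> set ms" for v
  proof -
    have "v \<in> U2 \<union> W2" "v \<noteq> x" "v \<noteq> y" using that ys ms un2 by auto
    then show ?thesis using ord(3,4) less2 mem by (metis Un_iff order_le_less)
  qed
  have disj: "set xs \<inter> set ms = {}"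
    using strict ord(1,2) xs(3) un1 by fastforce
  have xne: "xs \<noteq> []" using xs pq by auto
  define U W where "U = U1 \<union> U2" and "W = W1 \<union> W2"
  \<comment> \<open>Follow the first path from \<open>x\<close> to \<open>y\<close> and return
    through the interior of the second.\<close>
  define zs where "zs = xs @ rev ms"
  define H where "H = \<lparr>verts = set zs, edges = insert {hd zs, last zs} (path_edges zs)\<rparr>"
  have verts: "verts H = U \<union> W"
  proof -
    have "set zs = set xs \<union> set ys" using ms mem xs(3) un1 by (auto simp: zs_def)
    then show ?thesis using xs ys un1 un2 by (auto simp: H_def U_def W_def)
  qed
  \<comment> \<open>The junction of \<open>xs\<close> with \<open>rev ms\<close> is the last edge of
    \<open>ys\<close>, and the closing edge of \<open>zs\<close> is its first edge.\<close>
  have edges: "edges H = path_edges xs \<union> path_edges ys"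
    using xne ms xs(4,5)
    by (auto simp: H_def zs_def path_edges_append path_edges_rev last_rev hd_rev
        path_edges_append[of "[x]" "ms @ [y]", simplified] insert_commute)
  have sub: "edges H \<subseteq> edges H1 \<union> edges H2" using edges xs ys by auto
  have "ordered_graph H"
    using og sub verts un1 un2 by (auto simp: ordered_graph_def U_def W_def H_def) blast+
  then have cyc: "ordered_cycle (p + q - 2) H"
  proof (rule ordered_cycle_of_path[of zs, rotated 5])
    show "distinct zs" using xs ys ms disj by (auto simp: zs_def)
    show "length zs = p + q - 2" using xs(2) ys(2) ms by (simp add: zs_def)
    show "p + q - 2 \<ge> 3" using pq by simp
  qed (simp_all add: H_def)
  \<comment> \<open>The mixed pairs use the shared vertices: \<open>u \<le> x < w\<close> for
    \<open>u\<close> in \<open>U1\<close> and \<open>w\<close> in \<open>W2\<close>, and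
    \<open>u < y \<le> w\<close> for \<open>u\<close> in \<open>U2\<close> and \<open>w\<close> in
    \<open>W1\<close>.\<close>
  have less: "\<forall>u\<in>U. \<forall>w\<in>W. u < w"
    using less1 less2 ord xy unfolding U_def W_def
    by (metis Un_iff mem le_less_trans less_le_trans)
  have cross: "\<forall>d\<in>edges H. d \<inter> U \<noteq> {} \<and> d \<inter> W \<noteq> {}"
    using sub cross1 cross2 unfolding U_def W_def by blast
  \<comment> \<open>The outer extremes come from the first cycle and the inner ones from the second,
    so the glued cycle has borders \<open>e\<close> and \<open>g\<close>.\<close>
  have "Min U1 \<le> Min U2" "Max W2 \<le> Max W1" "Max U1 \<le> Max U2" "Min W2 \<le> Min W1"
    unfolding xy2 x_def[symmetric] y_def[symmetric] using mem fin by auto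
  then have "Min U = Min U1" "Max W = Max W1" "Max U = Max U2" "Min W = Min W2"
    using fin ne1 ne2
    by (simp_all add: U_def W_def Min_Un Max_Un min_absorb1 min_absorb2 max_absorb1 max_absorb2)
  then have eg: "e = outer_border U W" "g = inner_border U W"
    using bd1 bd2 by (simp_all add: outer_border_def inner_border_def)
  have "e \<noteq> f" "g \<noteq> f"
    using bordered_at_borders_neq[OF cyc1 un1 ne1 less1]
      bordered_at_borders_neq[OF cyc2 un2 ne2 less2] bd1 bd2 by auto
  then have "e \<in> edges H" "g \<in> edges H"
    using bd1 bd2 xs(6) ys(6) f edges by auto
  moreover have "U \<noteq> {}" "W \<noteq> {}" using ne1 by (simp_all add: U_def W_def)
  ultimately have "bordered_at (p + q - 2) H e g"
    using bordered_atI[OF cyc _ _ verts less cross] eg by simp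
  moreover have "verts H \<subseteq> verts G" "edges H \<subseteq> edges G"
    using verts sub H1 H2 un1 un2 by (auto simp: U_def W_def)
  ultimately show ?thesis unfolding cycle_in_def by blast
qed

section \<open>Chains of linked cycles and the choice of the largest class\<close>

text \<open>Each further link adds \<open>2 * l - 2\<close> to the length of the glued cycle. The
  exponent is a successor because the zeroth power is equality, which provides no cycle.\<close>

lemma cycle_in_relpowp:
  assumes "(cycle_in (2 * l) G ^^ Suc n) e f" "l \<ge> 1"
  shows "cycle_in (2 * (Suc n * (l - 1) + 1)) G e f"
  using assms(1)
proof (induction n arbitrary: f)
  case 0
  have eq: "2 * (Suc 0 * (l - 1) + 1) = 2 * l" using assms(2) by simp
  show ?case unfolding eq using 0 by (simp add: eq_OO)
next
  case (Suc n)
  then obtain d where "(cycle_in (2 * l) G ^^ Suc n) e d" "cycle_in (2 * l) G d f"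
    by (meson relpowp_Suc_E)
  then have "cycle_in (2 * (Suc n * (l - 1) + 1) + 2 * l - 2) G e f"
    using Suc.IH cycle_in_glue by blast
  moreover have "2 * (Suc n * (l - 1) + 1) + 2 * l - 2 = 2 * (Suc (Suc n) * (l - 1) + 1)"
    using assms(2) by (cases l) auto
  ultimately show ?case by (simp only:)
qed

theorem theorem4:
  fixes k l :: nat and G :: "'a::linorder ograph"
  assumes "k \<ge> 2" and "l \<ge> 2" and "(l - 1) dvd (k - 1)"
    and "ordered_graph G"
    and "free_of (bordered_cycles (2 * k)) G"
  shows "\<exists>G'. subgraph G' G \<and> free_of (bordered_cycles (2 * l)) G' \<and>
    real (card (edges G')) \<ge> (real l - 1) / (real k - 1) * real (card (edges G))"
proof -
  obtain m where m: "k - 1 = m * (l - 1)" using assms(3) by (auto simp: dvd_def mult.commute)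
  then have m0: "m > 0" using assms(1) by (cases m) auto
  define R where "R = cycle_in (2 * l) G"
  \<comment> \<open>Dropping the last link of a chain leaves a chain, so \<open>A n\<close> consists
    of the edges whose longest chain has exactly \<open>n\<close> links.\<close>
  define A where "A = (\<lambda>n. {e \<in> edges G. (\<exists>f. (R ^^ n) e f) \<and> (\<nexists>f. (R ^^ Suc n) e f)})"
  have noR: "\<not> (R ^^ m) e f" for e f
  proof
    assume "(R ^^ m) e f"
    then have "cycle_in (2 * (m * (l - 1) + 1)) G e f"
      using cycle_in_relpowp[where n = "m - 1" and G = G and l = l and e = e and f = f] m0 assms(2) by (simp add: R_def del: relpowp.simps)
    moreover have "m * (l - 1) + 1 = k" using m assms(1) by simp
    ultimately show False using assms(5) by (auto simp: free_of_bordered_cycles_iff)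
  qed
  have cover: "edges G \<subseteq> (\<Union>n<m. A n)"
  proof
    fix e assume e: "e \<in> edges G"
    \<comment> \<open>Every edge starts the empty chain, and none starts a chain of \<open>m\<close>
      links by \<open>noR\<close>, so the chain length must stop growing at some
      \<open>n < m\<close>.\<close>
    have "\<exists>n<m. (\<exists>f. (R ^^ n) e f) \<and> (\<nexists>f. (R ^^ Suc n) e f)"
    proof (rule ccontr)
      assume "\<not> ?thesis"
      then have step: "\<exists>f. (R ^^ Suc n) e f" if "n < m" "\<exists>f. (R ^^ n) e f" for n
        using that by blast
      have "n \<le> m \<Longrightarrow> \<exists>f. (R ^^ n) e f" for n
        by (induction n) (use step in \<open>auto simp del: relpowp.simps(2)\<close>)
      then show False using noR by blast
    qed
    then show "e \<in> (\<Union>n<m. A n)" using e by (auto simp: A_def)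
  qed
  have finE: "finite (edges G)"
  proof (rule finite_subset)
    show "edges G \<subseteq> Pow (verts G)" "finite (Pow (verts G))"
      using assms(4) by (auto simp: ordered_graph_def)
  qed
  have finA: "finite (A n)" for n using finE by (simp add: A_def)
  have "card (edges G) \<le> card (\<Union>n<m. A n)" using cover finA by (intro card_mono) auto
  also have "\<dots> \<le> (\<Sum>n<m. card (A n))" by (rule card_UN_le) simp
  finally have le: "card (edges G) \<le> (\<Sum>n<m. card (A n))" .
  \<comment> \<open>Averaging: if all \<open>m\<close> classes were smaller than the mean, they
    could not cover the edges.\<close>
  have "\<exists>n<m. card (edges G) \<le> m * card (A n)"
  proof (rule ccontr)
    assume "\<not> ?thesis"
    then have "(\<Sum>n<m. m * card (A n)) < (\<Sum>n<m. card (edges G))"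
      using m0 by (intro sum_strict_mono) (auto simp: not_le)
    then show False using le m0 by (simp add: sum_distrib_left[symmetric])
  qed
  then obtain n where n: "n < m" "card (edges G) \<le> m * card (A n)" by blast
  define G' where "G' = \<lparr>verts = verts G, edges = A n\<rparr>"
  have "subgraph G' G"
    using assms(4) by (auto simp: subgraph_def ordered_graph_def G'_def A_def)
  moreover have "free_of (bordered_cycles (2 * l)) G'"
    unfolding free_of_bordered_cycles_iff
  proof
    assume "\<exists>e f. cycle_in (2 * l) G' e f"
    then obtain e f where ef: "cycle_in (2 * l) G' e f" by blast
    \<comment> \<open>The inner border \<open>f\<close> starts a chain of \<open>n\<close> links;
      putting the link from \<open>e\<close> to \<open>f\<close> in front gives \<open>Suc n\<close>
      links at \<open>e\<close>, which \<open>e \<in> A n\<close> forbids.\<close>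
    then have "R e f" unfolding R_def cycle_in_def by (auto simp: G'_def A_def)
    moreover have "e \<in> A n" "f \<in> A n" using cycle_in_borders[OF ef] by (auto simp: G'_def)
    ultimately show False unfolding A_def by (auto simp del: relpowp.simps) (meson relpowp_Suc_I2)
  qed
  moreover have "(real l - 1) / (real k - 1) * real (card (edges G)) \<le> real (card (edges G'))"
  proof -
    have "real k - 1 = real m * (real l - 1)"
      using m assms(1,2) by (metis of_nat_1 of_nat_diff of_nat_mult one_le_numeral order_trans)
    moreover have "real l - 1 > 0" using assms(2) by simp
    ultimately have ratio: "(real l - 1) / (real k - 1) = 1 / real m" by simp
    have "real (card (edges G)) \<le> real m * real (card (A n))"
      using n(2) by (metis of_nat_le_iff of_nat_mult)
    then show ?thesis using m0 unfolding ratio by (simp add: G'_def field_simps)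
  qed
  ultimately show ?thesis by blast
qed

end
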